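(* Let $\Omega\subset\mathbb{R}^n$ be a smooth bounded domain with inner unit normal $\nu$ on $\partial\Omega$, and let $\tilde c_\beta>0$ and $K\ge0$ be constants. Then there exists a constant $C$, depending only on $\Omega$, $\tilde c_\beta$ and $K$, with the following property. Let $\beta$ be a unit vector field on $\partial\Omega$ with $\langle\beta,\nu\rangle\ge\tilde c_\beta$ on $\partial\Omega$, and let $u:\overline\Omega\to\mathbb{R}$ be a smooth strictly convex function with $|u_\beta|\le K$ on $\partial\Omega$. Then $\sup_{\Omega}|Du|\le C$. In particular, the bound is independent of $\sup|u|$.
   Context: A function is called strictly convex if its Hessian is positive definite. For a vector $\xi=(\xi^i)$ we write $u_\xi=\xi^iu_i=\langle Du,\xi\rangle$, so that $u_\beta=\langle Du,\beta\rangle$ on $\partial\Omega$. *)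

theory Defs
  imports "HOL-Analysis.Analysis"
begin

text \<open>
  Derivatives are taken within the set \<open>S\<close> on which the function lives. On an open set these are
  the ordinary derivatives. On the closure of a smooth domain they are still uniquely determined,
  so boundary values of the gradient and the Hessian make sense, and they do not
  depend on the values of the function outside \<open>S\<close>.
\<close>

definition grad :: "(real ^ 'n) set \<Rightarrow> (real ^ 'n \<Rightarrow> real) \<Rightarrow> real ^ 'n \<Rightarrow> real ^ 'n" where
  "grad S u x = (\<chi> i. frechet_derivative u (at x within S) (axis i 1))"

definition hessian :: "(real ^ 'n) set \<Rightarrow> (real ^ 'n \<Rightarrow> real) \<Rightarrow> real ^ 'n \<Rightarrow> real ^ 'n ^ 'n" where
  "hessian S u x = (\<chi> i j. grad S (\<lambda>y. grad S u y $ i) x $ j)"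

primrec Ck_on :: "nat \<Rightarrow> (real ^ 'n) set \<Rightarrow> (real ^ 'n \<Rightarrow> real) \<Rightarrow> bool" where
  "Ck_on 0 S u \<longleftrightarrow> continuous_on S u"
| "Ck_on (Suc k) S u \<longleftrightarrow>
     (\<forall>x\<in>S. u differentiable (at x within S)) \<and> (\<forall>i. Ck_on k S (\<lambda>x. grad S u x $ i))"

text \<open>
  When \<open>S\<close> is the closure of a bounded smooth domain, this is the usual space of functions that
  are smooth inside and all of whose derivatives extend continuously to the boundary.
\<close>

definition smooth_on :: "(real ^ 'n) set \<Rightarrow> (real ^ 'n \<Rightarrow> real) \<Rightarrow> bool" where
  "smooth_on S u \<longleftrightarrow> (\<forall>k. Ck_on k S u)"

definition pos_definite :: "real ^ 'n ^ 'n \<Rightarrow> bool" where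
  "pos_definite A \<longleftrightarrow> transpose A = A \<and> (\<forall>v. v \<noteq> 0 \<longrightarrow> v \<bullet> (A *v v) > 0)"

definition strictly_convex_on :: "(real ^ 'n) set \<Rightarrow> (real ^ 'n \<Rightarrow> real) \<Rightarrow> bool" where
  "strictly_convex_on S u \<longleftrightarrow> (\<forall>x\<in>S. pos_definite (hessian S u x))"

text \<open>
  A smooth defining function for \<open>\<Omega>\<close> near \<open>p\<close>. It vanishes in \<open>V\<close> exactly on the boundary, and
  \<open>\<Omega>\<close> lies locally on the side where it is positive, so that its gradient points into \<open>\<Omega>\<close>.
\<close>

definition local_defining_function ::
    "(real ^ 'n) set \<Rightarrow> real ^ 'n \<Rightarrow> (real ^ 'n) set \<Rightarrow> (real ^ 'n \<Rightarrow> real) \<Rightarrow> bool" where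
  "local_defining_function \<Omega> p V \<psi> \<longleftrightarrow>
     open V \<and> p \<in> V \<and> smooth_on V \<psi> \<and> (\<forall>x\<in>V. grad V \<psi> x \<noteq> 0) \<and>
     \<Omega> \<inter> V = {x \<in> V. \<psi> x > 0} \<and> frontier \<Omega> \<inter> V = {x \<in> V. \<psi> x = 0}"

definition smooth_domain :: "(real ^ 'n) set \<Rightarrow> bool" where
  "smooth_domain \<Omega> \<longleftrightarrow>
     open \<Omega> \<and> connected \<Omega> \<and> \<Omega> \<noteq> {} \<and>
     (\<forall>p\<in>frontier \<Omega>. \<exists>V \<psi>. local_defining_function \<Omega> p V \<psi>)"

text \<open>The vector below does not depend on the choice of the defining function.\<close>

definition inner_unit_normal :: "(real ^ 'n) set \<Rightarrow> real ^ 'n \<Rightarrow> real ^ 'n \<Rightarrow> bool" where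
  "inner_unit_normal \<Omega> p v \<longleftrightarrow>
     (\<exists>V \<psi>. local_defining_function \<Omega> p V \<psi> \<and> v = grad V \<psi> p /\<^sub>R norm (grad V \<psi> p))"

end

theory Submission imports Defs begin

text \<open>
  Let \<open>u\<close> attain its maximum over \<open>closure \<Omega>\<close> at the boundary point \<open>y\<^sub>0\<close>, and put \<open>w = u(y\<^sub>0) - u \<ge> 0\<close>.
  Since \<open>u\<^sub>\<beta> \<ge> -K\<close> at \<open>y\<^sub>0\<close>, convexity along the ray in direction \<open>\<beta>\<close> bounds \<open>w\<close> at an interior
  point at a fixed distance from the boundary. Along segments in \<open>\<Omega>\<close> the function \<open>w\<close> is concave
  and nonnegative, so it satisfies a Harnack inequality with a constant depending only on \<open>\<Omega>\<close>. Hence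
  \<open>w\<close> is bounded independently of \<open>u\<close>, first in the interior and then, by concavity, at every boundary
  point \<open>p\<close>. The vectors \<open>s \<beta> + e\<close> with \<open>|e| \<le> \<rho>\<close> point from \<open>p\<close> into \<open>\<Omega>\<close>, so
  \<open>s u\<^sub>\<beta> + \<langle>Du, e\<rangle> \<le> w(p)\<close>; with \<open>u\<^sub>\<beta> \<ge> -K\<close> this bounds \<open>|Du(p)|\<close>. At an interior point,
  the derivative in the direction of the gradient increases along that direction up to the boundary.
\<close>

section \<open>Gradient, Hessian and convexity along segments\<close>

lemma has_derivative_grad:
  fixes u :: "real ^ 'n \<Rightarrow> real"
  assumes "u differentiable (at x within S)"
  shows "(u has_derivative (\<lambda>v. grad S u x \<bullet> v)) (at x within S)"
proof -
  define D where "D = frechet_derivative u (at x within S)"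
  have D: "(u has_derivative D) (at x within S)"
    unfolding D_def using assms by (simp add: frechet_derivative_works[symmetric])
  then interpret bounded_linear D by (rule has_derivative_bounded_linear)
  have "D v = grad S u x \<bullet> v" for v
  proof -
    have "D v = D (\<Sum>i\<in>UNIV. (v $ i) *\<^sub>R axis i 1)"
      using basis_expansion[of v] by (simp add: scalar_mult_eq_scaleR)
    also have "\<dots> = (\<Sum>i\<in>UNIV. v $ i * D (axis i 1))"
      by (simp add: sum scaleR)
    also have "\<dots> = grad S u x \<bullet> v"
      by (simp add: inner_vec_def grad_def D_def mult.commute)
    finally show ?thesis .
  qed
  then have "D = (\<lambda>v. grad S u x \<bullet> v)" by auto
  with D show ?thesis by simp
qed

lemma has_derivative_grad_inner:
  fixes u :: "real ^ 'n \<Rightarrow> real"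
  assumes "Ck_on 2 S u" and "x \<in> S"
  shows "((\<lambda>y. grad S u y \<bullet> d) has_derivative (\<lambda>v. d \<bullet> (hessian S u x *v v))) (at x within S)"
proof -
  have diff: "(\<lambda>y. grad S u y $ i) differentiable (at x within S)" for i
    using assms by (simp add: numeral_2_eq_2)
  have "((\<lambda>y. \<Sum>i\<in>UNIV. grad S u y $ i * d $ i) has_derivative
      (\<lambda>v. \<Sum>i\<in>UNIV. (grad S (\<lambda>y. grad S u y $ i) x \<bullet> v) * d $ i)) (at x within S)"
    by (intro has_derivative_sum has_derivative_mult_left has_derivative_grad diff)
  moreover have "(\<Sum>i\<in>UNIV. (grad S (\<lambda>y. grad S u y $ i) x \<bullet> v) * d $ i)
      = d \<bullet> (hessian S u x *v v)" for v
    by (simp add: inner_vec_def matrix_vector_mult_def hessian_def mult.commute)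
  ultimately show ?thesis by (simp add: inner_vec_def)
qed


text \<open>Two uses of the mean value theorem along the segment: the increment of \<open>u\<close>
  is the slope at some \<open>t\<close>, and that slope exceeds the one at \<open>x\<close> by
  \<open>t\<close> times a nonnegative Hessian form. As \<open>S\<close> need not be convex, the
  segment itself is required to lie in it.\<close>

lemma first_order_convexity:
  fixes u :: "real ^ 'n \<Rightarrow> real"
  assumes "Ck_on 2 S u" and "strictly_convex_on S u" and seg: "closed_segment x y \<subseteq> S"
  shows "u x + grad S u x \<bullet> (y - x) \<le> u y"
proof -
  define d where "d = y - x"
  define p where "p t = x + t *\<^sub>R d" for t
  have p_in: "p t \<in> S" if "t \<in> {0..1}" for t
  proof -
    have "p t = (1 - t) *\<^sub>R x + t *\<^sub>R y" by (simp add: p_def d_def algebra_simps)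
    then have "p t \<in> closed_segment x y" using that by (auto simp: in_segment)
    then show ?thesis using seg by auto
  qed
  have p': "(p has_derivative (\<lambda>h. h *\<^sub>R d)) (at t within T)" for t T
    unfolding p_def by (auto intro!: derivative_eq_intros)
  \<comment> \<open>Derivatives are taken within \<open>S\<close>, so the chain rule needs the
    parameter interval to be mapped into \<open>S\<close>.\<close>
  have chain: "((\<lambda>t. f (p t)) has_derivative (\<lambda>h. f' (h *\<^sub>R d))) (at t within {a..b})"
    if "(f has_derivative f') (at (p t) within S)" "0 \<le> a" "b \<le> 1"
    for f :: "real ^ 'n \<Rightarrow> real" and f' t a b
    using has_derivative_in_compose[OF p' has_derivative_subset[OF that(1)]] p_in that(2,3)
    by (fastforce simp: image_subset_iff)
  have u': "(u has_derivative (\<lambda>v. grad S u z \<bullet> v)) (at z within S)" if "z \<in> S" for z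
    using assms(1) that by (intro has_derivative_grad) (simp add: numeral_2_eq_2)
  have "\<exists>t\<in>{0<..<1}. u (p 1) - u (p 0) = grad S u (p t) \<bullet> ((1 - 0) *\<^sub>R d)"
    by (rule mvt_simple, simp, rule chain[OF u']) (auto intro: p_in)
  then obtain t where t: "0 < t" "t < 1" "u (p 1) - u (p 0) = grad S u (p t) \<bullet> d"
    by auto
  have "\<exists>s\<in>{0<..<t}. grad S u (p t) \<bullet> d - grad S u (p 0) \<bullet> d
      = d \<bullet> (hessian S u (p s) *v ((t - 0) *\<^sub>R d))"
    using t by (intro mvt_simple[OF t(1)] chain[OF has_derivative_grad_inner[OF assms(1)]] p_in) auto
  then obtain s where s: "0 < s" "s < t"
      "grad S u (p t) \<bullet> d - grad S u (p 0) \<bullet> d = t * (d \<bullet> (hessian S u (p s) *v d))"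
    by (auto simp: matrix_vector_mult_scaleR)
  have "d \<bullet> (hessian S u (p s) *v d) \<ge> 0"
    using assms(2) p_in[of s] s t
    by (cases "d = 0") (auto simp: strictly_convex_on_def pos_definite_def intro!: less_imp_le)
  then have "t * (d \<bullet> (hessian S u (p s) *v d)) \<ge> 0" using t by simp
  then show ?thesis using s(3) t(3) by (simp add: p_def d_def)
qed

section \<open>A Harnack inequality from doubling\<close>

text \<open>Doubling compares an endpoint of a segment with its midpoint. Both reflections stay in
  the ball, so nearby points can be compared in either direction.\<close>

lemma reflected_segment_subset_ball:
  fixes a b :: "'a :: real_normed_vector"
  assumes "dist a b < r / 2"
  shows "closed_segment b (2 *\<^sub>R a - b) \<subseteq> ball a r" and "closed_segment a (2 *\<^sub>R b - a) \<subseteq> ball a r"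
proof -
  have r: "r > 0" using assms zero_le_dist[of a b] by linarith
  have "norm (2 *\<^sub>R (a - b)) < r" using assms by (simp add: dist_norm)
  moreover have "dist a (2 *\<^sub>R a - b) = dist a b" "dist a (2 *\<^sub>R b - a) = norm (2 *\<^sub>R (a - b))"
    by (simp_all add: dist_norm algebra_simps scaleR_2 norm_minus_commute)
  ultimately show "closed_segment b (2 *\<^sub>R a - b) \<subseteq> ball a r" "closed_segment a (2 *\<^sub>R b - a) \<subseteq> ball a r"
    using assms r by (simp_all add: closed_segment_subset)
qed

text \<open>Being comparable with a constant common to all of \<open>W\<close> is an equivalence
  relation with open classes, so a connected \<Omega> is a single class. The doubling hypothesis is
  what concavity and nonnegativity give: \<open>2 * w z\<close> is at least \<open>w x\<close> plus
  the value at the reflected point.\<close>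

lemma harnack_chain:
  fixes x y :: "'a :: real_normed_vector"
  assumes "open \<Omega>" and "connected \<Omega>" and "x \<in> \<Omega>" and "y \<in> \<Omega>"
    and "\<And>w x z. w \<in> W \<Longrightarrow> closed_segment x (2 *\<^sub>R z - x) \<subseteq> \<Omega> \<Longrightarrow> w x \<le> 2 * w z"
  shows "\<exists>H\<ge>0. \<forall>w\<in>W. w x \<le> H * (w y :: real)"
proof -
  define R where "R a b \<longleftrightarrow> (\<exists>H\<ge>0. \<forall>w\<in>W. w a \<le> H * w b) \<and> (\<exists>H\<ge>0. \<forall>w\<in>W. w b \<le> H * w a)"
    for a b
  have le_trans: "\<exists>H\<ge>0. \<forall>w\<in>W. w a \<le> H * w d"
    if ab: "\<exists>H\<ge>0. \<forall>w\<in>W. w a \<le> H * w b" and bd: "\<exists>H\<ge>0. \<forall>w\<in>W. w b \<le> H * w d" for a b d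
  proof -
    obtain H1 H2 where H: "H1 \<ge> 0" "\<forall>w\<in>W. w a \<le> H1 * w b" "H2 \<ge> 0" "\<forall>w\<in>W. w b \<le> H2 * w d"
      using ab bd by blast
    then have "w a \<le> (H1 * H2) * w d" if "w \<in> W" for w
      using that mult_left_mono[of "w b" "H2 * w d" H1] by (fastforce simp: mult.assoc)
    with H show ?thesis by (intro exI[of _ "H1 * H2"]) auto
  qed
  have "R x y"
  proof (rule connected_equivalence_relation[OF assms(2-4)])
    show "R b a" if "R a b" for a b using that by (auto simp: R_def)
    show "R a d" if "R a b" "R b d" for a b d
      using that le_trans[of a b d] le_trans[of d b a] by (auto simp: R_def)
    fix a assume "a \<in> \<Omega>"
    then obtain r where r: "r > 0" "ball a r \<subseteq> \<Omega>" using \<open>open \<Omega>\<close> openE by blast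
    have "R a b" if "b \<in> ball a (r / 2)" for b
    proof -
      have "closed_segment b (2 *\<^sub>R a - b) \<subseteq> ball a r" "closed_segment a (2 *\<^sub>R b - a) \<subseteq> ball a r"
        using that reflected_segment_subset_ball[of a b r] by auto
      then have "w b \<le> 2 * w a" "w a \<le> 2 * w b" if "w \<in> W" for w
        using assms(5)[OF that] r by blast+
      then show ?thesis unfolding R_def by (auto intro!: exI[of _ 2])
    qed
    moreover have "openin (top_of_set \<Omega>) (ball a (r / 2))"
      using r \<open>open \<Omega>\<close> by (intro open_openin_trans) auto
    ultimately show "\<exists>T. openin (top_of_set \<Omega>) T \<and> a \<in> T \<and> (\<forall>x\<in>T. R a x)"
      using r by (intro exI[of _ "ball a (r / 2)"]) auto
  qed
  then show ?thesis by (simp add: R_def)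
qed


text \<open>The centres of \<delta>-balls inside \<Omega> form a compact set. A finite net leaves
  finitely many pairs for the chain argument, and doubling passes between a point and its net point;
  two such passes cost the factor 4.\<close>

lemma uniform_harnack:
  fixes \<Omega> :: "'a :: euclidean_space set"
  assumes "open \<Omega>" and "connected \<Omega>" and "bounded \<Omega>" and "\<delta> > 0"
    and nonneg: "\<And>w x. w \<in> W \<Longrightarrow> x \<in> \<Omega> \<Longrightarrow> w x \<ge> 0"
    and double: "\<And>w x z. w \<in> W \<Longrightarrow> closed_segment x (2 *\<^sub>R z - x) \<subseteq> \<Omega> \<Longrightarrow> w x \<le> 2 * w z"
  shows "\<exists>H\<ge>0. \<forall>w\<in>W. \<forall>x y. ball x \<delta> \<subseteq> \<Omega> \<longrightarrow> ball y \<delta> \<subseteq> \<Omega> \<longrightarrow> w x \<le> H * (w y :: real)"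
proof -
  define T where "T = {x. ball x \<delta> \<subseteq> \<Omega>}"
  have T_sub: "T \<subseteq> \<Omega>" using \<open>\<delta> > 0\<close> by (auto simp: T_def)
  have "T = (\<Inter>y\<in>- \<Omega>. - ball y \<delta>)"
    by (auto simp: T_def dist_commute)
  then have "closed T" by (auto intro!: closed_INT)
  with T_sub \<open>bounded \<Omega>\<close> have "compact T"
    using bounded_subset compact_eq_bounded_closed by blast
  moreover have "T \<subseteq> (\<Union>f\<in>T. ball f (\<delta> / 2))" using \<open>\<delta> > 0\<close> by force
  ultimately obtain F where F: "F \<subseteq> T" "finite F" "T \<subseteq> (\<Union>f\<in>F. ball f (\<delta> / 2))"
    by (metis (no_types, lifting) compactE_image open_ball)
  have "\<forall>f\<in>F. \<forall>g\<in>F. \<exists>H\<ge>0. \<forall>w\<in>W. w f \<le> H * w g"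
    using F(1) T_sub by (intro ballI harnack_chain[OF assms(1,2)] double) auto
  then obtain h where h: "\<And>f g. f \<in> F \<Longrightarrow> g \<in> F \<Longrightarrow> h f g \<ge> 0 \<and> (\<forall>w\<in>W. w f \<le> h f g * w g)"
    by metis
  \<comment> \<open>The \<open>h f g\<close> are nonnegative, so their sum dominates each of them,
    without a separate case for an empty net.\<close>
  define H where "H = (\<Sum>f\<in>F. \<Sum>g\<in>F. h f g)"
  have h_le: "h f g \<le> H" if "f \<in> F" "g \<in> F" for f g
  proof -
    have "h f g \<le> (\<Sum>g\<in>F. h f g)" using F(2) that h by (intro member_le_sum) auto
    also have "\<dots> \<le> H" unfolding H_def using F(2) that h
      by (intro member_le_sum[of f F "\<lambda>f. \<Sum>g\<in>F. h f g"] sum_nonneg) auto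
    finally show ?thesis .
  qed
  have H0: "H \<ge> 0" unfolding H_def using h by (intro sum_nonneg) auto
  have "w x \<le> (4 * H) * w y" if w: "w \<in> W" and "x \<in> T" "y \<in> T" for w x y
  proof -
    have "\<exists>f\<in>F. dist f a < \<delta> / 2" if "a \<in> T" for a
      using subsetD[OF F(3) that] by simp
    then obtain f g where fg: "f \<in> F" "dist f x < \<delta> / 2" "g \<in> F" "dist g y < \<delta> / 2"
      using \<open>x \<in> T\<close> \<open>y \<in> T\<close> by blast
    have balls: "ball f \<delta> \<subseteq> \<Omega>" "ball g \<delta> \<subseteq> \<Omega>" using fg F(1) by (auto simp: T_def)
    have "w x \<le> 2 * w f"
      using double[OF w] reflected_segment_subset_ball(1)[OF fg(2)] balls by blast
    moreover have "w g \<le> 2 * w y"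
      using double[OF w] reflected_segment_subset_ball(2)[OF fg(4)] balls by blast
    moreover have "w f \<le> h f g * w g" using h fg w by blast
    moreover have "h f g * w g \<le> H * w g"
      using h_le fg F(1) T_sub nonneg[OF w] by (intro mult_right_mono) auto
    moreover have "H * w g \<le> H * (2 * w y)" using calculation(2) H0 by (rule mult_left_mono)
    ultimately show ?thesis by linarith
  qed
  then show ?thesis using H0 by (intro exI[of _ "4 * H"]) (auto simp: T_def)
qed

section \<open>Uniform cones at the boundary\<close>

text \<open>Near \<open>q\<close> the gradient of \<psi> is almost constant, so by the mean value
  theorem \<open>\<psi> (p + v)\<close> differs from its linear term by less than the cone margin
  and has the same sign. One radius serves all \<open>p\<close> near \<open>q\<close>, as
  compactness later needs; the outward half serves the uniqueness of the normal.\<close>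

lemma defining_function_cone:
  fixes \<Omega> :: "(real ^ 'n) set"
  assumes ldf: "local_defining_function \<Omega> q V \<psi>" and "q \<in> frontier \<Omega>" and "\<kappa> > 0"
  shows "\<exists>r>0. ball q r \<subseteq> V \<and> (\<forall>p\<in>frontier \<Omega> \<inter> ball q r. \<forall>v. v \<noteq> 0 \<longrightarrow> norm v < r \<longrightarrow>
      (v \<bullet> grad V \<psi> p \<ge> \<kappa> * norm v * norm (grad V \<psi> p) \<longrightarrow> p + v \<in> \<Omega>) \<and>
      (v \<bullet> grad V \<psi> p \<le> - (\<kappa> * norm v * norm (grad V \<psi> p)) \<longrightarrow> p + v \<notin> \<Omega>))"
proof -
  let ?G = "grad V \<psi>"
  have V: "open V" "q \<in> V" "?G q \<noteq> 0" and \<Omega>V: "\<Omega> \<inter> V = {x \<in> V. \<psi> x > 0}"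
    and frV: "frontier \<Omega> \<inter> V = {x \<in> V. \<psi> x = 0}" and "Ck_on (Suc 0) V \<psi>"
    using ldf by (auto simp: local_defining_function_def smooth_on_def)
  then have diff: "\<And>x. x \<in> V \<Longrightarrow> \<psi> differentiable (at x within V)"
    and "\<And>i. continuous_on V (\<lambda>x. ?G x $ i)" by auto
  then have "continuous_on V (\<lambda>x. \<chi> i. ?G x $ i)" by (intro continuous_on_vec_lambda)
  then have cont: "continuous_on V ?G" by simp
  define a where "a = norm (?G q)"
  have "a > 0" using V by (simp add: a_def)
  \<comment> \<open>The gradient will vary by less than \<open>2 * \<epsilon>\<close> and have norm
    above \<open>a - \<epsilon>\<close>. The divisor 8 gives \<open>2 * \<epsilon>\<close> \<le>
    \<open>\<kappa> * a / 4\<close> < \<open>\<kappa> * (7 * a / 8)\<close> \<le>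
    \<open>\<kappa> * (a - \<epsilon>)\<close>.\<close>
  define \<epsilon> where "\<epsilon> = (min 1 \<kappa>) * a / 8"
  have \<epsilon>: "\<epsilon> > 0" "\<epsilon> \<le> a / 8" "\<epsilon> \<le> \<kappa> * a / 8"
    using \<open>a > 0\<close> \<open>\<kappa> > 0\<close> mult_right_mono[of "min 1 \<kappa>" 1 a] mult_right_mono[of "min 1 \<kappa>" \<kappa> a]
    by (auto simp: \<epsilon>_def)
  have "continuous (at q) ?G" using cont V continuous_on_eq_continuous_at by blast
  then obtain r1 where r1: "r1 > 0" "\<And>x. dist x q < r1 \<Longrightarrow> dist (?G x) (?G q) < \<epsilon>"
    using \<epsilon>(1) unfolding continuous_at_eps_delta by blast
  obtain r2 where r2: "r2 > 0" "ball q r2 \<subseteq> V" using V openE by blast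
  \<comment> \<open>Halved because the segment from \<open>p\<close> to \<open>p + v\<close> may
    reach almost distance \<open>2 * r\<close> from \<open>q\<close>.\<close>
  define r where "r = min r1 r2 / 2"
  have r: "r > 0" "2 * r \<le> r1" "2 * r \<le> r2" using r1 r2 by (auto simp: r_def)
  have "(v \<bullet> ?G p \<ge> \<kappa> * norm v * norm (?G p) \<longrightarrow> p + v \<in> \<Omega>) \<and>
      (v \<bullet> ?G p \<le> - (\<kappa> * norm v * norm (?G p)) \<longrightarrow> p + v \<notin> \<Omega>)"
    if p: "p \<in> frontier \<Omega>" "dist q p < r" and v: "v \<noteq> 0" "norm v < r" for p v
  proof -
    have near: "dist (p + t *\<^sub>R v) q < 2 * r" if "0 \<le> t" "t \<le> 1" for t
    proof -
      have "norm (t *\<^sub>R v) \<le> norm v" using that by (simp add: mult_left_le_one_le)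
      moreover have "dist (p + t *\<^sub>R v) q \<le> dist q p + norm (t *\<^sub>R v)"
        using dist_triangle[of "p + t *\<^sub>R v" q p] by (simp add: dist_commute dist_norm)
      ultimately show ?thesis using p v by linarith
    qed
    then have inV: "p + t *\<^sub>R v \<in> V" if "0 \<le> t" "t \<le> 1" for t
      using that r r2 by (fastforce simp: dist_commute subset_iff)
    have "((\<lambda>t. \<psi> (p + t *\<^sub>R v)) has_derivative (\<lambda>h. ?G (p + t *\<^sub>R v) \<bullet> (h *\<^sub>R v))) (at t within {0..1})"
      if "0 \<le> t" "t \<le> 1" for t
    proof (rule has_derivative_compose[of "\<lambda>t. p + t *\<^sub>R v" "\<lambda>h. h *\<^sub>R v"])
      show "((\<lambda>t. p + t *\<^sub>R v) has_derivative (\<lambda>h. h *\<^sub>R v)) (at t within {0..1})"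
        by (auto intro!: derivative_eq_intros)
      show "(\<psi> has_derivative (\<lambda>x. ?G (p + t *\<^sub>R v) \<bullet> x)) (at (p + t *\<^sub>R v))"
        using has_derivative_grad[OF diff[OF inV[OF that]]] at_within_open[OF inV[OF that] V(1)] by simp
    qed
    from mvt_simple[OF zero_less_one this] obtain t where t: "0 < t" "t < 1"
      "\<psi> (p + v) - \<psi> p = ?G (p + t *\<^sub>R v) \<bullet> v" by auto
    have "\<psi> p = 0" using frV inV[of 0] p by auto
    have "dist (?G (p + t *\<^sub>R v)) (?G q) < \<epsilon>" "dist (?G p) (?G q) < \<epsilon>"
      using near[of t] near[of 0] t r by (auto intro!: r1(2))
    then have "norm (?G (p + t *\<^sub>R v) - ?G p) < 2 * \<epsilon>" "norm (?G p) > a - \<epsilon>"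
      using dist_triangle2[of "?G (p + t *\<^sub>R v)" "?G p" "?G q"] norm_triangle_ineq2[of "?G q" "?G p"]
      by (auto simp: dist_norm a_def norm_minus_commute)
    moreover have "\<kappa> * (a - \<epsilon>) > 2 * \<epsilon>"
    proof -
      have "\<kappa> * (a - \<epsilon>) \<ge> \<kappa> * (7 * a / 8)" using \<epsilon> \<open>\<kappa> > 0\<close> by (intro mult_left_mono) auto
      moreover have "\<kappa> * a > 0" using \<open>a > 0\<close> \<open>\<kappa> > 0\<close> by simp
      ultimately show ?thesis using \<epsilon>(3) by simp
    qed
    ultimately have "norm (?G (p + t *\<^sub>R v) - ?G p) < \<kappa> * norm (?G p)"
      using mult_strict_left_mono[of "a - \<epsilon>" "norm (?G p)" \<kappa>] \<open>\<kappa> > 0\<close> by linarith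
    then have "norm (?G (p + t *\<^sub>R v) - ?G p) * norm v < \<kappa> * norm v * norm (?G p)"
      using v by (simp add: mult.commute mult.left_commute)
    then have "\<bar>(?G (p + t *\<^sub>R v) - ?G p) \<bullet> v\<bar> < \<kappa> * norm v * norm (?G p)"
      using Cauchy_Schwarz_ineq2 le_less_trans by blast
    moreover have "\<psi> (p + v) = (?G (p + t *\<^sub>R v) - ?G p) \<bullet> v + v \<bullet> ?G p"
      using t(3) \<open>\<psi> p = 0\<close> by (simp add: inner_diff inner_commute)
    moreover have "p + v \<in> \<Omega> \<longleftrightarrow> \<psi> (p + v) > 0" using \<Omega>V inV[of 1] by auto
    ultimately show ?thesis by linarith
  qed
  then show ?thesis using r r2 by (intro exI[of _ r]) auto
qed

text \<open>If \<open>m\<close> and \<open>n\<close> differed, \<open>m - n\<close> would point into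
  \<Omega> by one defining function and out of it by the other.\<close>

lemma inner_unit_normal_unique:
  fixes \<Omega> :: "(real ^ 'n) set"
  assumes "inner_unit_normal \<Omega> p m" and "inner_unit_normal \<Omega> p n" and p: "p \<in> frontier \<Omega>"
  shows "m = n"
proof (rule ccontr)
  assume "m \<noteq> n"
  obtain V \<psi> where V: "local_defining_function \<Omega> p V \<psi>" "m = grad V \<psi> p /\<^sub>R norm (grad V \<psi> p)"
    using assms(1) by (auto simp: inner_unit_normal_def)
  obtain U \<phi> where U: "local_defining_function \<Omega> p U \<phi>" "n = grad U \<phi> p /\<^sub>R norm (grad U \<phi> p)"
    using assms(2) by (auto simp: inner_unit_normal_def)
  have nz: "grad V \<psi> p \<noteq> 0" "grad U \<phi> p \<noteq> 0"
    using V U by (auto simp: local_defining_function_def)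
  then have unit: "norm m = 1" "norm n = 1" using V U by auto
  have eqs: "grad V \<psi> p = norm (grad V \<psi> p) *\<^sub>R m" "grad U \<phi> p = norm (grad U \<phi> p) *\<^sub>R n"
    using V U nz by auto
  define v where "v = m - n"
  \<comment> \<open>For unit vectors, \<open>(m - n) \<bullet> m\<close> is half the square of
    \<open>norm (m - n)\<close>, so this \<kappa> makes both cone conditions hold with
    equality.\<close>
  define \<kappa> where "\<kappa> = norm v / 2"
  have "v \<noteq> 0" "\<kappa> > 0" using \<open>m \<noteq> n\<close> by (auto simp: v_def \<kappa>_def)
  have "norm v ^ 2 = 2 - 2 * (m \<bullet> n)"
    using unit by (simp add: v_def power2_norm_eq_inner inner_diff algebra_simps norm_eq_1 inner_commute)
  then have "\<kappa> * norm v = 1 - m \<bullet> n" by (simp add: \<kappa>_def power2_eq_square)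
  then have vm: "v \<bullet> m = \<kappa> * norm v" "v \<bullet> n = - (\<kappa> * norm v)"
    using unit by (auto simp: v_def inner_diff norm_eq_1 inner_commute)
  obtain r where r: "r > 0" "\<And>w. w \<noteq> 0 \<Longrightarrow> norm w < r \<Longrightarrow>
      w \<bullet> grad V \<psi> p \<ge> \<kappa> * norm w * norm (grad V \<psi> p) \<Longrightarrow> p + w \<in> \<Omega>"
    using defining_function_cone[OF V(1) p \<open>\<kappa> > 0\<close>] p by fastforce
  obtain s where s: "s > 0" "\<And>w. w \<noteq> 0 \<Longrightarrow> norm w < s \<Longrightarrow>
      w \<bullet> grad U \<phi> p \<le> - (\<kappa> * norm w * norm (grad U \<phi> p)) \<Longrightarrow> p + w \<notin> \<Omega>"
    using defining_function_cone[OF U(1) p \<open>\<kappa> > 0\<close>] p by fastforce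
  define t where "t = min r s / (2 * norm v)"
  have t: "t > 0" "norm (t *\<^sub>R v) < r" "norm (t *\<^sub>R v) < s"
    using r(1) s(1) \<open>v \<noteq> 0\<close> by (auto simp: t_def)
  have "(t *\<^sub>R v) \<bullet> grad V \<psi> p = \<kappa> * norm (t *\<^sub>R v) * norm (grad V \<psi> p)"
    using t(1) vm by (subst eqs(1)) simp
  then have "p + t *\<^sub>R v \<in> \<Omega>" using r(2) t \<open>v \<noteq> 0\<close> by simp
  have "(t *\<^sub>R v) \<bullet> grad U \<phi> p = - (\<kappa> * norm (t *\<^sub>R v) * norm (grad U \<phi> p))"
    using t(1) vm by (subst eqs(2)) simp
  then have "p + t *\<^sub>R v \<notin> \<Omega>" using s(2) t \<open>v \<noteq> 0\<close> by simp
  with \<open>p + t *\<^sub>R v \<in> \<Omega>\<close> show False by simp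
qed

text \<open>Defining functions are only local. Uniqueness of the normal identifies
  \<open>\<nu> p\<close> with the normalised gradient of whichever one covers \<open>p\<close>; a
  finite subcover of the compact boundary then gives a smallest radius.\<close>

lemma uniform_interior_cone:
  fixes \<Omega> :: "(real ^ 'n) set"
  assumes "smooth_domain \<Omega>" and "bounded \<Omega>"
    and normal: "\<forall>x\<in>frontier \<Omega>. inner_unit_normal \<Omega> x (\<nu> x)" and "\<kappa> > 0"
  shows "\<exists>r>0. \<forall>p\<in>frontier \<Omega>. \<forall>v. v \<noteq> 0 \<longrightarrow> norm v < r \<longrightarrow> v \<bullet> \<nu> p \<ge> \<kappa> * norm v \<longrightarrow> p + v \<in> \<Omega>"
proof -
  have "\<exists>r>0. \<forall>p\<in>frontier \<Omega> \<inter> ball q r. \<forall>v. v \<noteq> 0 \<longrightarrow> norm v < r \<longrightarrow> v \<bullet> \<nu> p \<ge> \<kappa> * norm v \<longrightarrow> p + v \<in> \<Omega>"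
    if q: "q \<in> frontier \<Omega>" for q
  proof -
    obtain V \<psi> where ldf: "local_defining_function \<Omega> q V \<psi>"
      using assms(1) q unfolding smooth_domain_def by blast
    from defining_function_cone[OF ldf q \<open>\<kappa> > 0\<close>] obtain r where r: "r > 0" "ball q r \<subseteq> V"
      and cone: "\<And>p v. p \<in> frontier \<Omega> \<Longrightarrow> p \<in> ball q r \<Longrightarrow> v \<noteq> 0 \<Longrightarrow> norm v < r \<Longrightarrow>
        v \<bullet> grad V \<psi> p \<ge> \<kappa> * norm v * norm (grad V \<psi> p) \<Longrightarrow> p + v \<in> \<Omega>"
      by blast
    have "p + v \<in> \<Omega>" if p: "p \<in> frontier \<Omega>" "p \<in> ball q r"
      and v: "v \<noteq> 0" "norm v < r" "v \<bullet> \<nu> p \<ge> \<kappa> * norm v" for p v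
    proof (rule cone[OF p v(1,2)])
      let ?g = "grad V \<psi> p"
      have "local_defining_function \<Omega> p V \<psi>"
        using ldf r p by (auto simp: local_defining_function_def)
      then have "?g \<noteq> 0" "inner_unit_normal \<Omega> p (?g /\<^sub>R norm ?g)"
        using r p by (auto simp: inner_unit_normal_def local_defining_function_def)
      then have "\<nu> p = ?g /\<^sub>R norm ?g" "?g \<noteq> 0"
        using normal p inner_unit_normal_unique by blast+
      then have "v \<bullet> ?g = (v \<bullet> \<nu> p) * norm ?g" by simp
      then show "v \<bullet> ?g \<ge> \<kappa> * norm v * norm ?g" using v(3) by (simp add: mult_right_mono)
    qed
    with r show ?thesis by blast
  qed
  then obtain \<rho> where \<rho>: "\<And>q. q \<in> frontier \<Omega> \<Longrightarrow> \<rho> q > 0 \<and> (\<forall>p\<in>frontier \<Omega> \<inter> ball q (\<rho> q).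
      \<forall>v. v \<noteq> 0 \<longrightarrow> norm v < \<rho> q \<longrightarrow> v \<bullet> \<nu> p \<ge> \<kappa> * norm v \<longrightarrow> p + v \<in> \<Omega>)"
    by metis
  have "compact (frontier \<Omega>)" using \<open>bounded \<Omega>\<close> by (rule compact_frontier_bounded)
  moreover have "frontier \<Omega> \<subseteq> (\<Union>q\<in>frontier \<Omega>. ball q (\<rho> q))" using \<rho> by force
  ultimately obtain F where F: "F \<subseteq> frontier \<Omega>" "finite F" "frontier \<Omega> \<subseteq> (\<Union>q\<in>F. ball q (\<rho> q))"
    by (metis (no_types, lifting) compactE_image open_ball)
  \<comment> \<open>The inserted 1 keeps the minimum over a nonempty set even for empty
    \<open>F\<close>.\<close>
  define r where "r = Min (insert 1 (\<rho> ` F))"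
  have "r > 0" using F \<rho> by (auto simp: r_def)
  moreover have "p + v \<in> \<Omega>"
    if p: "p \<in> frontier \<Omega>" and v: "v \<noteq> 0" "norm v < r" "v \<bullet> \<nu> p \<ge> \<kappa> * norm v" for p v
  proof -
    obtain q where q: "q \<in> F" "p \<in> ball q (\<rho> q)" using F(3) p by blast
    have "r \<le> \<rho> q" using F(2) q(1) by (simp add: r_def)
    then have "norm v < \<rho> q" using v(2) by simp
    with \<rho>[of q] q F(1) p v(1,3) show ?thesis by blast
  qed
  ultimately show ?thesis by blast
qed

text \<open>The bound \<open>c\<close> keeps \<open>b\<close> at a fixed angle from the tangent
  plane, so a small perturbation of \<open>s *\<^sub>R b\<close> stays in the interior cone. Both
  \<open>s\<close> and \<rho> are chosen before \<open>b\<close>, hence serve every field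
  \<beta>.\<close>

lemma uniform_oblique_cone:
  fixes \<Omega> :: "(real ^ 'n) set"
  assumes "smooth_domain \<Omega>" and "bounded \<Omega>"
    and normal: "\<forall>x\<in>frontier \<Omega>. inner_unit_normal \<Omega> x (\<nu> x)" and "c > 0"
  shows "\<exists>s>0. \<exists>\<rho>>0. \<forall>p\<in>frontier \<Omega>. \<forall>b e t. norm b = 1 \<longrightarrow> b \<bullet> \<nu> p \<ge> c \<longrightarrow> norm e \<le> \<rho> \<longrightarrow>
      0 < t \<longrightarrow> t \<le> 1 \<longrightarrow> p + t *\<^sub>R (s *\<^sub>R b + e) \<in> \<Omega>"
proof -
  obtain r where r: "r > 0" and cone: "\<And>p v. p \<in> frontier \<Omega> \<Longrightarrow> v \<noteq> 0 \<Longrightarrow> norm v < r \<Longrightarrow>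
      v \<bullet> \<nu> p \<ge> (c / 4) * norm v \<Longrightarrow> p + v \<in> \<Omega>"
    using uniform_interior_cone[OF assms(1-3), of "c / 4"] \<open>c > 0\<close> by auto
  \<comment> \<open>For \<open>v = s *\<^sub>R b + e\<close>, these choices and \<open>c\<close>
    \<le> 1 give \<open>norm v\<close> \<le> \<open>2 * s\<close> < \<open>r\<close> and
    \<open>v \<bullet> \<nu> p\<close> \<ge> \<open>s * c - \<rho>\<close> =
    \<open>s * c / 2\<close> \<ge> \<open>(c / 4) * norm v\<close>.\<close>
  define s where "s = r / 4"
  define \<rho> where "\<rho> = s * c / 2"
  have s\<rho>: "s > 0" "\<rho> > 0" using r \<open>c > 0\<close> by (auto simp: s_def \<rho>_def)
  have "p + t *\<^sub>R (s *\<^sub>R b + e) \<in> \<Omega>"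
    if p: "p \<in> frontier \<Omega>" and b: "norm b = 1" "b \<bullet> \<nu> p \<ge> c" and e: "norm e \<le> \<rho>" and t: "0 < t" "t \<le> 1"
    for p b e t
  proof (rule cone[OF p])
    obtain V \<psi> where "local_defining_function \<Omega> p V \<psi>" "\<nu> p = grad V \<psi> p /\<^sub>R norm (grad V \<psi> p)"
      using normal p by (auto simp: inner_unit_normal_def)
    then have \<nu>: "norm (\<nu> p) = 1" by (auto simp: local_defining_function_def)
    have "c \<le> 1" using norm_cauchy_schwarz[of b "\<nu> p"] b \<nu> by simp
    then have "s * c \<le> s" using s\<rho> by (simp add: mult_left_le)
    define v where "v = s *\<^sub>R b + e"
    have nv: "norm v \<le> s + \<rho>"
      using norm_triangle_ineq[of "s *\<^sub>R b" e] b e s\<rho> by (simp add: v_def)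
    also have "\<dots> \<le> 2 * s" using \<open>s * c \<le> s\<close> s\<rho> by (simp add: \<rho>_def)
    finally have nv: "norm v \<le> 2 * s" .
    have "\<bar>e \<bullet> \<nu> p\<bar> \<le> \<rho>" using Cauchy_Schwarz_ineq2[of e "\<nu> p"] e \<nu> by simp
    moreover have "s * (b \<bullet> \<nu> p) \<ge> s * c" using b s\<rho> by simp
    ultimately have v\<nu>: "v \<bullet> \<nu> p \<ge> s * c / 2" by (simp add: v_def inner_add_left \<rho>_def)
    also have "s * c / 2 \<ge> (c / 4) * norm v"
      using mult_left_mono[OF nv, of "c / 4"] \<open>c > 0\<close> by (simp add: mult.commute)
    finally have "(c / 4) * norm v \<le> v \<bullet> \<nu> p" .
    then have "t * ((c / 4) * norm v) \<le> t * (v \<bullet> \<nu> p)" using t by (intro mult_left_mono) auto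
    then show "(t *\<^sub>R (s *\<^sub>R b + e)) \<bullet> \<nu> p \<ge> (c / 4) * norm (t *\<^sub>R (s *\<^sub>R b + e))"
      using t by (simp add: v_def[symmetric] mult.left_commute)
    have "v \<noteq> 0" using v\<nu> mult_pos_pos[OF s\<rho>(1) \<open>c > 0\<close>] by auto
    then show "t *\<^sub>R (s *\<^sub>R b + e) \<noteq> 0" using t by (simp add: v_def)
    have "norm (t *\<^sub>R v) \<le> norm v" using t by (simp add: mult_left_le_one_le)
    then show "norm (t *\<^sub>R (s *\<^sub>R b + e)) < r" using nv r by (simp add: v_def s_def)
  qed
  with s\<rho> show ?thesis by blast
qed

section \<open>The gradient estimate\<close>

text \<open>The ray is stopped at its first exit, so the whole segment stays in the closure although
  \<Omega> need not be convex.\<close>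

lemma segment_to_frontier:
  fixes \<Omega> :: "'a :: euclidean_space set"
  assumes "open \<Omega>" and "bounded \<Omega>" and "x \<in> \<Omega>" and "l \<noteq> 0"
  obtains d where "d > 0" and "x + d *\<^sub>R l \<in> frontier \<Omega>" and "closed_segment x (x + d *\<^sub>R l) \<subseteq> closure \<Omega>"
proof -
  have "x \<in> interior \<Omega>" using assms by (simp add: interior_open)
  with assms obtain d where d: "d > 0" "x + d *\<^sub>R l \<in> frontier \<Omega>"
      "\<And>e. 0 \<le> e \<Longrightarrow> e < d \<Longrightarrow> x + e *\<^sub>R l \<in> interior \<Omega>"
    using ray_to_frontier by metis
  have "x + e *\<^sub>R l \<in> closure \<Omega>" if "0 \<le> e" "e \<le> d" for e
  proof (cases "e = d")
    case True
    then show ?thesis using d(2) by (simp add: frontier_def)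
  next
    case False
    then have "x + e *\<^sub>R l \<in> interior \<Omega>" using d(3) that by simp
    then show ?thesis using interior_subset closure_subset by blast
  qed
  then have "x + (t * d) *\<^sub>R l \<in> closure \<Omega>" if "0 \<le> t" "t \<le> 1" for t
    using that d(1) mult_right_mono[of t 1 d] by simp
  moreover have "(1 - t) *\<^sub>R x + t *\<^sub>R (x + d *\<^sub>R l) = x + (t * d) *\<^sub>R l" for t
    by (simp add: algebra_simps)
  ultimately have "closed_segment x (x + d *\<^sub>R l) \<subseteq> closure \<Omega>" by (auto simp: in_segment)
  with d that show ?thesis by blast
qed

theorem theorem3p1:
  fixes \<Omega> :: "(real ^ 'n) set" and \<nu> :: "real ^ 'n \<Rightarrow> real ^ 'n" and c K :: real
  assumes "smooth_domain \<Omega>" and "bounded \<Omega>"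
    and "\<forall>x\<in>frontier \<Omega>. inner_unit_normal \<Omega> x (\<nu> x)"
    and "c > 0" and "K \<ge> 0"
  shows "\<exists>C::real. \<forall>(\<beta> :: real ^ 'n \<Rightarrow> real ^ 'n) (u :: real ^ 'n \<Rightarrow> real).
    (\<forall>x\<in>frontier \<Omega>. norm (\<beta> x) = 1) \<longrightarrow>
    (\<forall>x\<in>frontier \<Omega>. \<beta> x \<bullet> \<nu> x \<ge> c) \<longrightarrow>
    smooth_on (closure \<Omega>) u \<longrightarrow>
    strictly_convex_on (closure \<Omega>) u \<longrightarrow>
    (\<forall>x\<in>frontier \<Omega>. \<bar>grad (closure \<Omega>) u x \<bullet> \<beta> x\<bar> \<le> K) \<longrightarrow>
    (SUP x\<in>\<Omega>. ereal (norm (grad (closure \<Omega>) u x))) \<le> ereal C"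
proof -
  have \<Omega>: "open \<Omega>" "connected \<Omega>" "\<Omega> \<noteq> {}" using assms(1) by (auto simp: smooth_domain_def)
  define S where "S = closure \<Omega>"
  have S: "S = \<Omega> \<union> frontier \<Omega>" "compact S"
    using \<open>bounded \<Omega>\<close> closure_Un_frontier[of \<Omega>] compact_closure[of \<Omega>] by (simp_all only: S_def)
  obtain s \<rho> where s\<rho>: "s > 0" "\<rho> > 0"
    and cone: "\<And>p b e t. p \<in> frontier \<Omega> \<Longrightarrow> norm b = 1 \<Longrightarrow> b \<bullet> \<nu> p \<ge> c \<Longrightarrow> norm e \<le> \<rho> \<Longrightarrow>
      0 < t \<Longrightarrow> t \<le> 1 \<Longrightarrow> p + t *\<^sub>R (s *\<^sub>R b + e) \<in> \<Omega>"
    using uniform_oblique_cone[OF assms(1-4)] by blast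
  \<comment> \<open>\<open>W\<close> mentions neither \<open>u\<close> nor \<beta>, so the Harnack
    constant is fixed before they are chosen. The radius \<open>\<rho> / 2\<close> is that of the
    balls about \<open>q p\<close> below.\<close>
  define W :: "(real ^ 'n \<Rightarrow> real) set" where "W = {w. (\<forall>x\<in>\<Omega>. w x \<ge> 0) \<and>
      (\<forall>x z. closed_segment x (2 *\<^sub>R z - x) \<subseteq> \<Omega> \<longrightarrow> w x \<le> 2 * w z)}"
  have "\<rho> / 2 > 0" using s\<rho> by simp
  obtain H where H: "H \<ge> 0" "\<And>w x y. w \<in> W \<Longrightarrow> ball x (\<rho> / 2) \<subseteq> \<Omega> \<Longrightarrow> ball y (\<rho> / 2) \<subseteq> \<Omega> \<Longrightarrow> w x \<le> H * w y"
  proof -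
    have "\<exists>H\<ge>0. \<forall>w\<in>W. \<forall>x y. ball x (\<rho> / 2) \<subseteq> \<Omega> \<longrightarrow> ball y (\<rho> / 2) \<subseteq> \<Omega> \<longrightarrow> w x \<le> H * w y"
      by (rule uniform_harnack[OF \<Omega>(1,2) \<open>bounded \<Omega>\<close> \<open>\<rho> / 2 > 0\<close>]) (auto simp: W_def)
    with that show ?thesis by blast
  qed
  \<comment> \<open>Obtained from
    \<open>s * (?g p \<bullet> \<beta> p) + \<rho> * norm (?g p)\<close> \<le> \<open>w p\<close>
    with \<open>w p\<close> \<le> \<open>2 * w (q p)\<close> \<le> \<open>2 * (H * w (q y0))\<close>
    and \<open>w (q y0)\<close> \<le> \<open>s / 2 * K\<close>.\<close>
  define C where "C = (2 * (H * (s / 2 * K)) + s * K) / \<rho>"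
  have gradient_bound: "norm (grad S u x) \<le> C"
    if \<beta>: "\<And>x. x \<in> frontier \<Omega> \<Longrightarrow> norm (\<beta> x) = 1" "\<And>x. x \<in> frontier \<Omega> \<Longrightarrow> \<beta> x \<bullet> \<nu> x \<ge> c"
      and u: "smooth_on S u" "strictly_convex_on S u"
      and K: "\<And>x. x \<in> frontier \<Omega> \<Longrightarrow> \<bar>grad S u x \<bullet> \<beta> x\<bar> \<le> K"
      and x: "x \<in> \<Omega>" for \<beta> u x
  proof -
    let ?g = "grad S u"
    have first_order: "u x + ?g x \<bullet> (y - x) \<le> u y" if "closed_segment x y \<subseteq> S" for x y
      using u that by (intro first_order_convexity) (auto simp: smooth_on_def)
    \<comment> \<open>The tangent inequalities at \<open>z\<close> towards the two ends are added;
      the gradient terms cancel.\<close>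
    have midpoint: "2 * u z \<le> u x + u (2 *\<^sub>R z - x)" if seg: "closed_segment x (2 *\<^sub>R z - x) \<subseteq> S" for x z
    proof -
      have "z = midpoint x (2 *\<^sub>R z - x)" by (simp add: midpoint_def)
      then have "z \<in> closed_segment x (2 *\<^sub>R z - x)" by (metis midpoint_in_closed_segment)
      then have "closed_segment z x \<subseteq> S" "closed_segment z (2 *\<^sub>R z - x) \<subseteq> S"
        using seg by (meson subset_closed_segment ends_in_segment order_trans)+
      from first_order[OF this(1)] first_order[OF this(2)] show ?thesis
        by (simp add: inner_diff_right scaleR_2 inner_add_right)
    qed
    have "continuous_on S u" using u(1) unfolding smooth_on_def by (metis Ck_on.simps(1))
    with S \<Omega> obtain y1 where y1: "y1 \<in> S" "\<And>y. y \<in> S \<Longrightarrow> u y \<le> u y1"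
      using continuous_attains_sup[of S u] by auto
    have "\<exists>y0\<in>frontier \<Omega>. u y1 \<le> u y0"
    proof (cases "y1 \<in> \<Omega>")
      case True
      \<comment> \<open>The all-ones vector, with the sign for which \<open>u\<close> does not
        decrease up to the exit point, which is then a maximum too.\<close>
      define l :: "real ^ 'n" where "l = (if ?g y1 \<bullet> 1 \<ge> 0 then 1 else - 1)"
      have "l \<noteq> 0" "?g y1 \<bullet> l \<ge> 0" by (auto simp: l_def)
      then obtain d where "d > 0" "y1 + d *\<^sub>R l \<in> frontier \<Omega>" "closed_segment y1 (y1 + d *\<^sub>R l) \<subseteq> S"
        using segment_to_frontier[OF \<Omega>(1) \<open>bounded \<Omega>\<close> True] unfolding S_def by metis
      with first_order[of y1 "y1 + d *\<^sub>R l"] \<open>?g y1 \<bullet> l \<ge> 0\<close> show ?thesis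
        by (intro bexI[of _ "y1 + d *\<^sub>R l"]) (auto simp: mult_nonneg_nonneg intro: order_trans[rotated])
    qed (use y1 S in auto)
    then obtain y0 where y0: "y0 \<in> frontier \<Omega>" "\<And>y. y \<in> S \<Longrightarrow> u y \<le> u y0"
      using y1(2) order_trans by blast
    define w where "w y = u y0 - u y" for y
    have w_double: "w y \<le> 2 * w z" if "closed_segment y (2 *\<^sub>R z - y) \<subseteq> S" for y z
      using midpoint[OF that] y0(2)[of "2 *\<^sub>R z - y"] that by (auto simp: w_def)
    then have wW: "w \<in> W" using y0(2) S by (fastforce simp: W_def w_def)
    have inward: "closed_segment p (p + (s *\<^sub>R \<beta> p + e)) \<subseteq> S" if "p \<in> frontier \<Omega>" "norm e \<le> \<rho>" for p e
    proof -
      have "(1 - t) *\<^sub>R p + t *\<^sub>R (p + (s *\<^sub>R \<beta> p + e)) = p + t *\<^sub>R (s *\<^sub>R \<beta> p + e)" for t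
        by (simp add: algebra_simps)
      moreover have "p + t *\<^sub>R (s *\<^sub>R \<beta> p + e) \<in> S" if "0 \<le> t" "t \<le> 1" for t
        using cone[of p "\<beta> p" e t] \<beta> that \<open>p \<in> frontier \<Omega>\<close> \<open>norm e \<le> \<rho>\<close> S
        by (cases "t = 0") auto
      ultimately show ?thesis by (auto simp: in_segment)
    qed
    \<comment> \<open>The midpoint of \<open>p\<close> and \<open>p + s *\<^sub>R \<beta> p\<close>,
      so doubling bounds \<open>w p\<close> by \<open>2 * w (q p)\<close>. At
      \<open>t = 1 / 2\<close> the perturbations \<open>e\<close> fill a ball of radius
      \<open>\<rho> / 2\<close> about it.\<close>
    define q where "q p = p + (s / 2) *\<^sub>R \<beta> p" for p
    have q_ball: "ball (q p) (\<rho> / 2) \<subseteq> \<Omega>" if p: "p \<in> frontier \<Omega>" for p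
    proof
      fix y assume "y \<in> ball (q p) (\<rho> / 2)"
      then have "norm (2 *\<^sub>R (y - q p)) \<le> \<rho>" by (simp add: dist_norm norm_minus_commute)
      from cone[OF p \<beta>(1,2)[OF p] this, of "1 / 2"]
      have "p + (1 / 2) *\<^sub>R (s *\<^sub>R \<beta> p + 2 *\<^sub>R (y - q p)) \<in> \<Omega>" by simp
      moreover have "p + (1 / 2) *\<^sub>R (s *\<^sub>R \<beta> p + 2 *\<^sub>R (y - q p)) = y"
        by (simp add: q_def scaleR_right_distrib)
      ultimately show "y \<in> \<Omega>" by simp
    qed
    have q_seg: "closed_segment p (2 *\<^sub>R q p - p) \<subseteq> S" if "p \<in> frontier \<Omega>" for p
      using inward[OF that, of 0] s\<rho> by (simp add: q_def scaleR_right_distrib scaleR_2 algebra_simps)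
    have wq: "w (q y0) \<le> s / 2 * K"
    proof -
      have "q y0 = midpoint y0 (2 *\<^sub>R q y0 - y0)" by (simp add: midpoint_def)
      then have "q y0 \<in> closed_segment y0 (2 *\<^sub>R q y0 - y0)" by (metis midpoint_in_closed_segment)
      then have "closed_segment y0 (q y0) \<subseteq> S"
        using q_seg[OF y0(1)] by (meson subset_closed_segment ends_in_segment order_trans)
      from first_order[OF this] have "w (q y0) \<le> s / 2 * (- (?g y0 \<bullet> \<beta> y0))"
        by (simp add: w_def q_def)
      also have "\<dots> \<le> s / 2 * K" using K[OF y0(1)] s\<rho> by (intro mult_left_mono) auto
      finally show ?thesis .
    qed
    have boundary: "norm (?g p) \<le> C" if p: "p \<in> frontier \<Omega>" for p
    proof -
      have "w p \<le> 2 * w (q p)" using w_double q_seg[OF p] by blast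
      also have "w (q p) \<le> H * w (q y0)" using H(2)[OF wW] q_ball p y0(1) by blast
      also have "H * w (q y0) \<le> H * (s / 2 * K)" using wq H(1) by (rule mult_left_mono)
      finally have wp: "w p \<le> 2 * (H * (s / 2 * K))" by simp
      \<comment> \<open>Makes \<open>?g p \<bullet> e\<close> equal to
        \<open>\<rho> * norm (?g p)\<close>, also when the gradient vanishes, since
        \<open>sgn 0 = 0\<close>.\<close>
      define e where "e = \<rho> *\<^sub>R sgn (?g p)"
      have "norm e \<le> \<rho>" using s\<rho> by (simp add: e_def norm_sgn)
      note seg = inward[OF p this]
      from first_order[OF seg] y0(2)[of "p + (s *\<^sub>R \<beta> p + e)"] seg
      have "s * (?g p \<bullet> \<beta> p) + ?g p \<bullet> e \<le> w p" by (auto simp: w_def inner_add_right)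
      moreover have "?g p \<bullet> e = \<rho> * norm (?g p)"
        by (cases "?g p = 0") (simp_all add: e_def sgn_div_norm power2_norm_eq_inner[symmetric] power2_eq_square)
      moreover have "s * (?g p \<bullet> \<beta> p) \<ge> s * (- K)" using K[OF p] s\<rho> by (intro mult_left_mono) auto
      ultimately have "\<rho> * norm (?g p) \<le> 2 * (H * (s / 2 * K)) + s * K" using wp by simp
      then show ?thesis using s\<rho> by (simp add: C_def pos_le_divide_eq mult.commute)
    qed
    show "norm (?g x) \<le> C"
    proof (cases "?g x = 0")
      case True
      \<comment> \<open>A zero gradient gives no ray; \<open>C\<close> \<ge> 0 is read off from the
        boundary estimate at \<open>y0\<close>.\<close>
      then show ?thesis using order_trans[OF norm_ge_zero boundary[OF y0(1)]] by simp
    next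
      case False
      define z where "z d = x + d *\<^sub>R ?g x" for d
      from False obtain d where d: "d > 0" "z d \<in> frontier \<Omega>" "closed_segment x (z d) \<subseteq> S"
        using segment_to_frontier[OF \<Omega>(1) \<open>bounded \<Omega>\<close> x] unfolding S_def z_def by metis
      \<comment> \<open>Adding the tangent inequalities from both ends of the segment gives
        monotonicity of the gradient along it.\<close>
      have "d * (?g x \<bullet> ?g x) \<le> d * (?g (z d) \<bullet> ?g x)"
        using first_order[OF d(3)] first_order[of "z d" x] d(3)
        by (simp add: z_def closed_segment_commute)
      then have "norm (?g x) * norm (?g x) \<le> ?g (z d) \<bullet> ?g x"
        using d(1) by (simp add: power2_norm_eq_inner[symmetric] power2_eq_square)
      also have "\<dots> \<le> norm (?g (z d)) * norm (?g x)" by (rule norm_cauchy_schwarz)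
      finally have "norm (?g x) \<le> norm (?g (z d))" using False by simp
      with boundary[OF d(2)] show ?thesis by simp
    qed
  qed
  show ?thesis
  proof (intro exI[of _ C] allI impI SUP_least)
    fix \<beta> u x
    assume "\<forall>x\<in>frontier \<Omega>. norm (\<beta> x) = 1" "\<forall>x\<in>frontier \<Omega>. \<beta> x \<bullet> \<nu> x \<ge> c"
      "smooth_on (closure \<Omega>) u" "strictly_convex_on (closure \<Omega>) u"
      "\<forall>x\<in>frontier \<Omega>. \<bar>grad (closure \<Omega>) u x \<bullet> \<beta> x\<bar> \<le> K" "x \<in> \<Omega>"
    then show "ereal (norm (grad (closure \<Omega>) u x)) \<le> ereal C"
      using gradient_bound[of \<beta> u x] by (simp add: S_def)
  qed
qed

end
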